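(* Let $k\geq 1$ be an integer, let $n_1,\dots,n_k\in\mathbb{Z}_{\geq 0}$, let $\alpha>0$ be real, and let $\mathbf{x}=(x_1,\dots,x_k)\in\mathbb{R}^k$ with $x_j\geq 0$ for $j=1,\dots,k$. Put $\|\mathbf{x}\|:=\max_{1\leq j\leq k}|x_j|$. Then $$\left|L_{n_1,\dots,n_k}^{(\alpha)}(\mathbf{x})\right|\leq 2^{k-1}\,\frac{(\alpha+1)_{n_1+\cdots+n_k}}{\left(\frac{1}{k}\right)_{n_1}\cdots\left(\frac{1}{k}\right)_{n_k}}\,\mathrm{e}^{\|\mathbf{x}\|/2},$$ where $L_{n_1,\dots,n_k}^{(\alpha)}$ denotes Erdélyi's multivariate Laguerre polynomial.
   Context: $(a)_n$ denotes the Pochhammer symbol (rising factorial): $(a)_0=1$ and $(a)_n=a(a+1)\cdots(a+n-1)$ for $n\geq 1$. Erdélyi's multivariate Laguerre polynomials $L_{n_1,\dots,n_k}^{(\alpha)}(\mathbf{x})=L_{n_1,\dots,n_k}^{(\alpha)}(x_1,\dots,x_k)$ in $k$ variables are defined by the generating function $$(1-z_1-\cdots-z_k)^{-\alpha-1}\exp\left(-\frac{x_1z_1+\cdots+x_kz_k}{1-z_1-\cdots-z_k}\right)=\sum_{n_1,\dots,n_k=0}^{\infty}L_{n_1,\dots,n_k}^{(\alpha)}(x_1,\dots,x_k)\,z_1^{n_1}\cdots z_k^{n_k},\qquad |z_1|+\cdots+|z_k|<1.$$ Equivalently (Erdélyi), $$L_{n_1,\dots,n_k}^{(\alpha)}(\mathbf{x})=\frac{(\alpha+1)_{n_1+\cdots+n_k}}{n_1!\cdots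 n_k!}\,\Phi_2^{(k)}\left[-n_1,\dots,-n_k;\alpha+1;\mathbf{x}\right],$$ where $$\Phi_2^{(k)}[b_1,\dots,b_k;c;\mathbf{x}]:=\sum_{j_1=0}^{\infty}\cdots\sum_{j_k=0}^{\infty}\frac{(b_1)_{j_1}\cdots(b_k)_{j_k}}{(c)_{j_1+\cdots+j_k}}\frac{x_1^{j_1}}{j_1!}\cdots\frac{x_k^{j_k}}{j_k!}$$ (a finite sum when $b_i=-n_i$ for all $i$). *)

theory Defs
  imports "HOL-Analysis.Analysis"
begin

text \<open>
  The number of variables is the cardinality of the finite index type; variables and multi-indices
  are both indexed by that type. The generating function is taken at complex arguments. Since
  \<^term>\<open>1 - (\<Sum>i\<in>UNIV. z $ i)\<close> has positive real part on the domain considered below, the complex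
  power is the principal branch there.
\<close>

definition erdelyi_laguerre_gf :: "real \<Rightarrow> real ^ 'k \<Rightarrow> complex ^ 'k \<Rightarrow> complex" where
  "erdelyi_laguerre_gf \<alpha> x z =
     (1 - (\<Sum>i\<in>UNIV. z $ i)) powr (- of_real \<alpha> - 1) *
     exp (- ((\<Sum>i\<in>UNIV. of_real (x $ i) * z $ i) / (1 - (\<Sum>i\<in>UNIV. z $ i))))"

text \<open>
  The polynomials are the coefficients of the expansion on the domain where the moduli of the
  arguments sum to less than one. That such coefficients exist, are real and are unique is shown
  in \<open>has_sum_erdelyi_laguerre\<close> and \<open>erdelyi_laguerre_eqI\<close>; the representation
  by the confluent function \<open>\<Phi>\<^sub>2\<close> is \<open>erdelyi_laguerre_Phi2\<close>.
\<close>

definition erdelyi_laguerre :: "real \<Rightarrow> ('k \<Rightarrow> nat) \<Rightarrow> real ^ 'k \<Rightarrow> real" where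
  "erdelyi_laguerre \<alpha> n x =
     (THE L. \<forall>z :: complex ^ 'k. (\<Sum>i\<in>UNIV. norm (z $ i)) < 1 \<longrightarrow>
        ((\<lambda>m. of_real (L m) * (\<Prod>i\<in>UNIV. z $ i ^ m i)) has_sum erdelyi_laguerre_gf \<alpha> x z)
          (UNIV :: ('k \<Rightarrow> nat) set)) n"

lemma multinomial_PiE:
  fixes z :: "'i \<Rightarrow> 'a :: {banach, real_normed_field}"
  assumes "finite A"
  shows "finite {n \<in> A \<rightarrow>\<^sub>E (UNIV :: nat set). sum n A = r} \<and>
    (\<Sum>n | n \<in> A \<rightarrow>\<^sub>E UNIV \<and> sum n A = r. \<Prod>i\<in>A. z i ^ n i / fact (n i)) = sum z A ^ r / fact r"
  using assms
proof (induction A arbitrary: r rule: finite_induct)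
  case empty
  have "{n. n = (\<lambda>x. undefined) \<and> r = 0} = (if r = 0 then {\<lambda>x. undefined} else {} :: ('i \<Rightarrow> nat) set)"
    by auto
  then show ?case by (cases r) (auto simp: eq_commute[of 0])
next
  case (insert a A)
  let ?S = "\<lambda>m. {n \<in> A \<rightarrow>\<^sub>E (UNIV :: nat set). sum n A = m}"
  let ?g = "\<lambda>(m, n). n(a := m)"
  have upd: "sum (g(a := m)) A = sum g A" for g and m :: nat
    using insert by (intro sum.cong) auto
  have img: "{n \<in> insert a A \<rightarrow>\<^sub>E UNIV. sum n (insert a A) = r} = ?g ` (SIGMA m:{..r}. ?S (r - m))"
  proof (intro equalityI subsetI)
    fix n assume "n \<in> {n \<in> insert a A \<rightarrow>\<^sub>E UNIV. sum n (insert a A) = r}"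
    then obtain m g where g: "n = g(a := m)" "g \<in> A \<rightarrow>\<^sub>E UNIV" "sum n (insert a A) = r"
      unfolding PiE_insert_eq by auto
    then have "m + sum g A = r" using insert upd[of g m] by simp
    then have "(m, g) \<in> (SIGMA m:{..r}. ?S (r - m))" using g by auto
    then show "n \<in> ?g ` (SIGMA m:{..r}. ?S (r - m))" using g(1) by force
  next
    fix n assume "n \<in> ?g ` (SIGMA m:{..r}. ?S (r - m))"
    then obtain m g where g: "n = g(a := m)" "g \<in> A \<rightarrow>\<^sub>E UNIV" "m \<le> r" "sum g A = r - m"
      by auto
    then have "n \<in> insert a A \<rightarrow>\<^sub>E UNIV" unfolding PiE_insert_eq by force
    moreover have "sum n (insert a A) = r" using g insert upd[of g m] by simp
    ultimately show "n \<in> {n \<in> insert a A \<rightarrow>\<^sub>E UNIV. sum n (insert a A) = r}" by simp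
  qed
  have inj: "inj_on ?g (SIGMA m:{..r}. ?S (r - m))"
    by (rule inj_on_subset[OF inj_combinator[of a A "\<lambda>_. UNIV"]]) (use insert in auto)
  have "(\<Sum>n | n \<in> insert a A \<rightarrow>\<^sub>E UNIV \<and> sum n (insert a A) = r. \<Prod>i\<in>insert a A. z i ^ n i / fact (n i))
     = (\<Sum>p\<in>(SIGMA m:{..r}. ?S (r - m)). \<Prod>i\<in>insert a A. z i ^ (?g p) i / fact ((?g p) i))"
    by (subst img) (rule sum.reindex_cong[OF inj refl refl])
  also have "\<dots> = (\<Sum>p\<in>(SIGMA m:{..r}. ?S (r - m)). z a ^ fst p / fact (fst p) * (\<Prod>i\<in>A. z i ^ snd p i / fact (snd p i)))"
  proof (intro sum.cong refl)
    fix p assume "p \<in> (SIGMA m:{..r}. ?S (r - m))"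
    have "(\<Prod>i\<in>A. z i ^ ?g p i / fact (?g p i)) = (\<Prod>i\<in>A. z i ^ snd p i / fact (snd p i))"
      using insert by (intro prod.cong refl) (auto simp: case_prod_beta)
    then show "(\<Prod>i\<in>insert a A. z i ^ ?g p i / fact (?g p i)) =
        z a ^ fst p / fact (fst p) * (\<Prod>i\<in>A. z i ^ snd p i / fact (snd p i))"
      using insert by (simp add: case_prod_beta)
  qed
  also have "\<dots> = (\<Sum>m\<le>r. \<Sum>n\<in>?S (r - m). z a ^ m / fact m * (\<Prod>i\<in>A. z i ^ n i / fact (n i)))"
    using insert.IH by (subst sum.Sigma) (auto intro!: sum.cong)
  also have "\<dots> = (\<Sum>m\<le>r. z a ^ m / fact m * (sum z A ^ (r - m) / fact (r - m)))"
    using insert.IH by (simp only: sum_distrib_left[symmetric])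
  also have "\<dots> = sum z (insert a A) ^ r / fact r"
    using insert exp_series_add_commuting[of "z a" "sum z A" r]
    by (simp add: scaleR_conv_of_real field_simps)
  finally show ?case
    using insert.IH by (auto simp: img intro!: finite_imageI finite_SigmaI)
qed

lemma has_sum_degree:
  fixes z :: "'k::finite \<Rightarrow> complex" and c :: "nat \<Rightarrow> complex"
  assumes "summable (\<lambda>r. norm (c r) * (\<Sum>i\<in>UNIV. norm (z i)) ^ r / fact r)"
  shows "((\<lambda>n. c (sum n UNIV) * (\<Prod>i\<in>UNIV. z i ^ n i / fact (n i))) has_sum
           (\<Sum>r. c r * (\<Sum>i\<in>UNIV. z i) ^ r / fact r)) UNIV"
    and "((\<lambda>n. norm (c (sum n UNIV)) * (\<Prod>i\<in>UNIV. norm (z i) ^ n i / fact (n i))) has_sum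
           (\<Sum>r. norm (c r) * (\<Sum>i\<in>UNIV. norm (z i)) ^ r / fact r)) UNIV"
proof -
  let ?S = "\<lambda>r. {n :: 'k \<Rightarrow> nat. sum n UNIV = r}"
  have S: "finite (?S r)" for r
    using multinomial_PiE[OF finite[of "UNIV::'k set"], of r "\<lambda>_. 0::real"] by simp
  have M: "(\<Sum>n\<in>?S r. \<Prod>i\<in>UNIV. w i ^ n i / fact (n i)) = sum w UNIV ^ r / fact r"
    for r and w :: "'k \<Rightarrow> 'a::{banach, real_normed_field}"
    using multinomial_PiE[OF finite[of "UNIV::'k set"], of r w] by simp
  have bij: "bij_betw snd (SIGMA r:UNIV. ?S r) UNIV"
    by (auto simp: bij_betw_def inj_on_def image_def)
  have rs: "((\<lambda>n. h n) has_sum s) UNIV \<longleftrightarrow> ((\<lambda>p. h (snd p)) has_sum s) (SIGMA r:UNIV. ?S r)"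
    for h :: "('k \<Rightarrow> nat) \<Rightarrow> 'b::{topological_comm_monoid_add}" and s
    by (rule has_sum_reindex_bij_betw[OF bij, symmetric])
  let ?f = "\<lambda>n. c (sum n UNIV) * (\<Prod>i\<in>UNIV. z i ^ n i / fact (n i))"
  have nf: "norm (?f n) = norm (c (sum n UNIV)) * (\<Prod>i\<in>UNIV. norm (z i) ^ n i / fact (n i))" for n
    by (simp add: norm_mult prod_norm[symmetric] norm_divide norm_power)
  have A: "((\<lambda>n. ?f (snd (r, n))) has_sum c r * (\<Sum>i\<in>UNIV. z i) ^ r / fact r) (?S r)" for r
    using S M[of z r] by (intro has_sum_finiteI) (auto simp: sum_distrib_left[symmetric])
  have B: "((\<lambda>n. norm (?f (snd (r, n)))) has_sum norm (c r) * (\<Sum>i\<in>UNIV. norm (z i)) ^ r / fact r) (?S r)" for r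
    using S M[of "\<lambda>i. norm (z i)" r] unfolding nf
    by (intro has_sum_finiteI) (auto simp: sum_distrib_left[symmetric])
  have G: "((\<lambda>r. norm (c r) * (\<Sum>i\<in>UNIV. norm (z i)) ^ r / fact r) has_sum
       (\<Sum>r. norm (c r) * (\<Sum>i\<in>UNIV. norm (z i)) ^ r / fact r)) UNIV"
    using assms by (intro norm_summable_imp_has_sum) (auto simp: sum_nonneg summable_sums)
  have sm: "(\<lambda>p. norm (?f (snd p))) summable_on (SIGMA r:UNIV. ?S r)"
    using G by (intro summable_on_SigmaI[OF B]) (auto simp: summable_on_def)
  have "((\<lambda>p. norm (?f (snd p))) has_sum
         (\<Sum>r. norm (c r) * (\<Sum>i\<in>UNIV. norm (z i)) ^ r / fact r)) (SIGMA r:UNIV. ?S r)"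
    by (rule has_sum_SigmaI[OF B G sm])
  then show "((\<lambda>n. norm (c (sum n UNIV)) * (\<Prod>i\<in>UNIV. norm (z i) ^ n i / fact (n i))) has_sum
           (\<Sum>r. norm (c r) * (\<Sum>i\<in>UNIV. norm (z i)) ^ r / fact r)) UNIV"
    unfolding rs nf .
  have sg: "summable (\<lambda>r. norm (c r * (\<Sum>i\<in>UNIV. z i) ^ r / fact r))"
    by (rule summable_comparison_test[OF _ assms])
      (auto simp: norm_mult norm_divide norm_power intro!: divide_right_mono mult_left_mono power_mono norm_sum)
  have G': "((\<lambda>r. c r * (\<Sum>i\<in>UNIV. z i) ^ r / fact r) has_sum
       (\<Sum>r. c r * (\<Sum>i\<in>UNIV. z i) ^ r / fact r)) UNIV"
    using sg summable_norm_cancel[OF sg] by (intro norm_summable_imp_has_sum) (auto simp: summable_sums)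
  show "(?f has_sum (\<Sum>r. c r * (\<Sum>i\<in>UNIV. z i) ^ r / fact r)) UNIV"
    unfolding rs by (rule has_sum_SigmaI[OF A G' abs_summable_summable[OF sm]])
qed

lemma pochhammer_sums:
  fixes s b :: complex
  assumes "norm s < 1"
  shows "(\<lambda>r. pochhammer b r * s ^ r / fact r) sums (1 - s) powr (- b)"
proof -
  have "(\<lambda>r. ((-b) gchoose r) * (-s) ^ r) sums (1 + (-s)) powr (- b)"
    using assms by (intro gen_binomial_complex) auto
  moreover have "((-b) gchoose r) * (-s) ^ r = pochhammer b r * s ^ r / fact r" for r
  proof -
    have "(-1::complex) ^ r * (-s) ^ r = s ^ r" by (simp add: power_mult_distrib[symmetric])
    then show ?thesis by (simp add: gbinomial_pochhammer)
  qed
  ultimately show ?thesis by simp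
qed

lemma pochhammer_sums_real:
  fixes s b :: real
  assumes "\<bar>s\<bar> < 1"
  shows "(\<lambda>r. pochhammer b r * s ^ r / fact r) sums (1 - s) powr (- b)"
proof -
  have "(\<lambda>r. ((-b) gchoose r) * (-s) ^ r) sums (1 + (-s)) powr (- b)"
    using assms by (intro gen_binomial_real) auto
  moreover have "((-b) gchoose r) * (-s) ^ r = pochhammer b r * s ^ r / fact r" for r
  proof -
    have "(-1::real) ^ r * (-s) ^ r = s ^ r" by (simp add: power_mult_distrib[symmetric])
    then show ?thesis by (simp add: gbinomial_pochhammer)
  qed
  ultimately show ?thesis by simp
qed

lemma norm_pochhammer_le:
  fixes b :: "'a::{real_normed_field}"
  shows "norm (pochhammer b r) \<le> pochhammer (norm b) r"
proof -
  have "norm (b + of_nat i) \<le> norm b + real i" for i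
    using norm_triangle_ineq[of b "of_nat i"] by simp
  then show ?thesis
    by (auto simp: pochhammer_prod prod_norm[symmetric] intro!: prod_mono)
qed

lemma powser_zero_coeffs:
  fixes e :: "nat \<Rightarrow> complex"
  assumes "\<epsilon> > 0" "\<And>t. norm t < \<epsilon> \<Longrightarrow> (\<lambda>m. e m * t ^ m) sums 0"
  shows "e m = 0"
proof (induction m rule: less_induct)
  case (less m)
  have "((\<lambda>_. 0 :: complex) \<longlongrightarrow> e (0 + m)) (at (0::complex))"
  proof (rule powser_limit_0_strong[of \<epsilon> "\<lambda>n. e (n + m)" "\<lambda>_. 0", OF assms(1)])
    fix t :: complex assume t: "t \<noteq> 0" "norm t < \<epsilon>"
    have "(\<lambda>n. e (n + m) * t ^ (n + m)) sums (0 - (\<Sum>n<m. e n * t ^ n))"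
      by (rule sums_split_initial_segment[OF assms(2)[OF t(2)]])
    then have "(\<lambda>n. t ^ m * (e (n + m) * t ^ n)) sums (t ^ m * 0)"
      using less by (simp add: power_add mult_ac)
    then show "(\<lambda>n. e (n + m) * t ^ n) sums 0"
      using t(1) sums_mult_iff[of "t ^ m" "\<lambda>n. e (n + m) * t ^ n" 0] by simp
  qed
  from LIM_unique[OF this tendsto_const] show ?case by simp
qed

lemma multi_powser_zero:
  fixes d :: "('i \<Rightarrow> nat) \<Rightarrow> complex"
  assumes "finite A" "\<epsilon> > 0"
    and "\<And>z. (\<And>i. i \<in> A \<Longrightarrow> norm (z i) < \<epsilon>) \<Longrightarrow> ((\<lambda>n. d n * (\<Prod>i\<in>A. z i ^ n i)) has_sum 0) (A \<rightarrow>\<^sub>E UNIV)"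
    and "n \<in> A \<rightarrow>\<^sub>E UNIV"
  shows "d n = 0"
  using assms(1,3,4)
proof (induction A arbitrary: d n rule: finite_induct)
  case empty
  then show ?case using has_sum_finite[of "{\<lambda>x. undefined}" "\<lambda>n. d n"]
    by (auto simp: has_sum_finite_iff)
next
  case (insert a A)
  let ?g = "\<lambda>(m, n). n(a := m)"
  have inj: "inj_on ?g ((UNIV :: nat set) \<times> (A \<rightarrow>\<^sub>E UNIV))"
    by (rule inj_combinator) (use insert in auto)
  have img: "insert a A \<rightarrow>\<^sub>E (UNIV :: nat set) = ?g ` (UNIV \<times> (A \<rightarrow>\<^sub>E UNIV))"
    by (rule PiE_insert_eq)
  have bij: "bij_betw ?g ((UNIV :: nat set) \<times> (A \<rightarrow>\<^sub>E UNIV)) (insert a A \<rightarrow>\<^sub>E UNIV)"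
    unfolding bij_betw_def by (intro conjI inj img[symmetric])
  have *: "((\<lambda>n. d (n(a := m)) * (\<Prod>i\<in>A. z i ^ n i)) has_sum 0) (A \<rightarrow>\<^sub>E UNIV)"
    if z: "\<And>i. i \<in> A \<Longrightarrow> norm (z i) < \<epsilon>" for z m
  proof -
    let ?h = "\<lambda>t p. t ^ fst p * (d ((snd p)(a := fst p)) * (\<Prod>i\<in>A. z i ^ snd p i))"
    have hs: "(?h t has_sum 0) (UNIV \<times> (A \<rightarrow>\<^sub>E UNIV))" if "norm t < \<epsilon>" for t
    proof -
      have "((\<lambda>n. d n * (\<Prod>i\<in>insert a A. (z(a := t)) i ^ n i)) has_sum 0) (insert a A \<rightarrow>\<^sub>E UNIV)"
        by (rule insert.prems(1)) (use z that insert in auto)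
      then have "((\<lambda>p. d (?g p) * (\<Prod>i\<in>insert a A. (z(a := t)) i ^ ?g p i)) has_sum 0) (UNIV \<times> (A \<rightarrow>\<^sub>E UNIV))"
        by (subst has_sum_reindex_bij_betw[OF bij])
      also have "(\<lambda>p. d (?g p) * (\<Prod>i\<in>insert a A. (z(a := t)) i ^ ?g p i)) = ?h t"
      proof
        fix p :: "nat \<times> ('i \<Rightarrow> nat)"
        have "(\<Prod>i\<in>A. (z(a := t)) i ^ ?g p i) = (\<Prod>i\<in>A. z i ^ snd p i)"
          using insert by (intro prod.cong) (auto split: prod.split)
        then show "d (?g p) * (\<Prod>i\<in>insert a A. (z(a := t)) i ^ ?g p i) = ?h t p"
          using insert by (cases p) (simp add: mult_ac)
      qed
      finally show ?thesis .
    qed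
    define e where "e m = (\<Sum>\<^sub>\<infinity>n\<in>A \<rightarrow>\<^sub>E UNIV. d (n(a := m)) * (\<Prod>i\<in>A. z i ^ n i))" for m
    have slice: "(\<lambda>n. F (m, n)) summable_on B" if "F summable_on (UNIV \<times> B)"
      for F :: "nat \<times> ('i \<Rightarrow> nat) \<Rightarrow> complex" and B m
      using summable_on_SigmaD1[of "\<lambda>m n. F (m, n)" UNIV "\<lambda>_. B" m] that by (simp add: case_prod_eta)
    have inner: "((\<lambda>n. d (n(a := m)) * (\<Prod>i\<in>A. z i ^ n i)) has_sum e m) (A \<rightarrow>\<^sub>E UNIV)" for m
    proof -
      let ?t = "of_real (\<epsilon> / 2) :: complex"
      have "(?h ?t) summable_on (UNIV \<times> (A \<rightarrow>\<^sub>E UNIV))"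
        using hs[of ?t] assms(2) by (auto simp: summable_on_def)
      then have "(\<lambda>n. ?h ?t (m, n)) summable_on (A \<rightarrow>\<^sub>E UNIV)"
        by (rule slice)
      then have "(\<lambda>n. ?t ^ m * (d (n(a := m)) * (\<Prod>i\<in>A. z i ^ n i))) summable_on (A \<rightarrow>\<^sub>E UNIV)"
        by simp
      then have "(\<lambda>n. d (n(a := m)) * (\<Prod>i\<in>A. z i ^ n i)) summable_on (A \<rightarrow>\<^sub>E UNIV)"
        by (subst (asm) summable_on_cmult_right') (use assms(2) in auto)
      then show ?thesis by (simp add: e_def)
    qed
    have "(\<lambda>m. e m * t ^ m) sums 0" if "norm t < \<epsilon>" for t
    proof (rule has_sum_imp_sums, rule has_sum_SigmaD[OF hs[OF that]])
      fix m :: nat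
      show "((\<lambda>n. ?h t (m, n)) has_sum e m * t ^ m) (A \<rightarrow>\<^sub>E UNIV)"
        using has_sum_cmult_right[OF inner, of "t ^ m"] by (simp add: mult.commute)
    qed
    then have "e m = 0" by (rule powser_zero_coeffs[OF assms(2)])
    then show ?thesis using inner[of m] by simp
  qed
  obtain m n' where n: "n = n'(a := m)" "n' \<in> A \<rightarrow>\<^sub>E UNIV"
    using insert.prems(2) unfolding img by auto
  show ?case using insert.IH[of "\<lambda>n. d (n(a := m))" n'] * n by blast
qed

lemma summable_pochhammer:
  fixes b :: complex and S :: real
  assumes "0 \<le> S" "S < 1"
  shows "summable (\<lambda>r. norm (pochhammer b r) * S ^ r / fact r)"
    and "(\<Sum>r. norm (pochhammer b r) * S ^ r / fact r) \<le> (1 - S) powr (- norm b)"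
proof -
  have s: "(\<lambda>r. pochhammer (norm b) r * S ^ r / fact r) sums (1 - S) powr (- norm b)"
    using assms by (intro pochhammer_sums_real) auto
  have le: "norm (pochhammer b r) * S ^ r / fact r \<le> pochhammer (norm b) r * S ^ r / fact r" for r
    using assms by (intro divide_right_mono mult_right_mono norm_pochhammer_le) auto
  show *: "summable (\<lambda>r. norm (pochhammer b r) * S ^ r / fact r)"
    by (rule summable_comparison_test[OF _ sums_summable[OF s]]) (use le assms in auto)
  show "(\<Sum>r. norm (pochhammer b r) * S ^ r / fact r) \<le> (1 - S) powr (- norm b)"
    using suminf_le[OF le * sums_summable[OF s]] sums_unique[OF s] by simp
qed

text \<open>
  An auxiliary closed form for the coefficients, obtained by multiplying out the generating
  function; it serves only to establish that the definition by generating function is proper.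
\<close>

definition laguerre_coeff :: "real \<Rightarrow> real ^ 'k \<Rightarrow> ('k::finite \<Rightarrow> nat) \<Rightarrow> real" where
  "laguerre_coeff \<alpha> x n = (\<Sum>j | \<forall>i. j i \<le> n i.
     pochhammer (\<alpha> + 1 + real (sum j UNIV)) (sum n UNIV - sum j UNIV) *
     (\<Prod>i\<in>UNIV. (- (x $ i)) ^ j i / (fact (j i) * fact (n i - j i))))"

lemma has_sum_laguerre_coeff:
  fixes z :: "complex ^ 'k::finite" and x :: "real ^ 'k"
  assumes "(\<Sum>i\<in>UNIV. norm (z $ i)) < 1"
  shows "((\<lambda>n. of_real (laguerre_coeff \<alpha> x n) * (\<Prod>i\<in>UNIV. z $ i ^ n i)) has_sum erdelyi_laguerre_gf \<alpha> x z) UNIV"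
proof -
  define a :: complex where "a = of_real \<alpha> + 1"
  define s where "s = (\<Sum>i\<in>UNIV. z $ i)"
  define S where "S = (\<Sum>i\<in>UNIV. norm (z $ i))"
  define w where "w i = - (of_real (x $ i) * z $ i)" for i
  define P where "P j = (\<Prod>i\<in>UNIV. w i ^ j i / fact (j i))" for j :: "'k \<Rightarrow> nat"
  define f where "f = (\<lambda>(j, l). P j * (pochhammer (a + of_nat (sum j UNIV)) (sum l UNIV) *
        (\<Prod>i\<in>UNIV. z $ i ^ l i / fact (l i))))"
  have S: "0 \<le> S" "S < 1" using assms by (auto simp: S_def sum_nonneg)
  have "norm s \<le> S" unfolding s_def S_def by (rule norm_sum)
  then have ns: "norm s < 1" using S by simp
  then have s1: "1 - s \<noteq> 0" by auto
  have powr: "(1 - s) powr (- (a + of_nat m)) = (1 - s) powr (- a) / (1 - s) ^ m" for m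
    using s1 by (simp add: powr_diff powr_nat')
  have i1: "((\<lambda>l. f (j, l)) has_sum (1 - s) powr (- a) / (1 - s) ^ sum j UNIV * P j) UNIV" for j
  proof -
    let ?b = "a + of_nat (sum j UNIV)"
    have "((\<lambda>l. pochhammer ?b (sum l UNIV) * (\<Prod>i\<in>UNIV. z $ i ^ l i / fact (l i))) has_sum
       (\<Sum>r. pochhammer ?b r * s ^ r / fact r)) UNIV"
      unfolding s_def by (rule has_sum_degree) (use summable_pochhammer(1)[OF S] in \<open>simp add: S_def\<close>)
    also have "(\<Sum>r. pochhammer ?b r * s ^ r / fact r) = (1 - s) powr (- ?b)"
      using pochhammer_sums[OF ns] sums_unique by metis
    finally show ?thesis unfolding powr f_def using has_sum_cmult_right by (fastforce simp: mult.commute)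
  qed
  have summ: "(\<lambda>p. norm (f p)) summable_on (UNIV \<times> UNIV)"
  proof -
    let ?b = "\<lambda>j. a + of_nat (sum j UNIV)"
    let ?N = "\<lambda>j. \<Sum>r. norm (pochhammer (?b j) r) * S ^ r / fact r"
    have nrm: "((\<lambda>l. norm (f (j, l))) has_sum norm (P j) * ?N j) UNIV" for j
    proof -
      have "((\<lambda>l. norm (pochhammer (?b j) (sum l UNIV)) * (\<Prod>i\<in>UNIV. norm (z $ i) ^ l i / fact (l i))) has_sum ?N j) UNIV"
        unfolding S_def by (rule has_sum_degree) (use summable_pochhammer(1)[OF S] in \<open>simp add: S_def\<close>)
      from has_sum_cmult_right[OF this, of "norm (P j)"] show ?thesis
        unfolding f_def by (simp add: norm_mult prod_norm[symmetric] norm_divide norm_power)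
    qed
    define T where "T = (\<Sum>i\<in>UNIV. norm (w i))"
    define c :: "nat \<Rightarrow> complex" where "c r = of_real ((1 - S) powr (- norm a) * (1 / (1 - S)) ^ r)" for r
    have nc: "norm (c r) = (1 - S) powr (- norm a) * (1 / (1 - S)) ^ r" for r
      unfolding c_def norm_of_real using S by (intro abs_of_nonneg) auto
    have "summable (\<lambda>r. (1 - S) powr (- norm a) * ((T / (1 - S)) ^ r /\<^sub>R fact r))"
      by (intro summable_mult summable_exp_generic)
    also have "(\<lambda>r. (1 - S) powr (- norm a) * ((T / (1 - S)) ^ r /\<^sub>R fact r)) = (\<lambda>r. norm (c r) * T ^ r / fact r)"
      by (simp add: nc fun_eq_iff field_simps)
    finally have "((\<lambda>j. norm (c (sum j UNIV)) * (\<Prod>i\<in>UNIV. norm (w i) ^ j i / fact (j i))) has_sum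
           (\<Sum>r. norm (c r) * T ^ r / fact r)) UNIV"
      unfolding T_def by (rule has_sum_degree)
    then have sc: "(\<lambda>j. norm (c (sum j UNIV)) * norm (P j)) summable_on UNIV"
      unfolding P_def by (auto simp: summable_on_def norm_mult prod_norm[symmetric] norm_divide norm_power)
    have N0: "?N j \<ge> 0" for j
      using S by (intro suminf_nonneg summable_pochhammer) auto
    have Nle: "?N j \<le> norm (c (sum j UNIV))" for j
    proof -
      have "?N j \<le> (1 - S) powr (- norm (?b j))" by (rule summable_pochhammer(2)[OF S])
      also have "\<dots> \<le> (1 - S) powr (- (norm a + real (sum j UNIV)))"
        using S norm_triangle_ineq[of a "of_nat (sum j UNIV)"] by (intro powr_mono') (auto simp del: of_nat_sum)
      also have "\<dots> = norm (c (sum j UNIV))"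
        using S by (simp add: nc powr_diff powr_realpow power_one_over del: of_nat_sum)
      finally show ?thesis .
    qed
    have "(\<lambda>j. norm (P j) * ?N j) summable_on UNIV"
      by (rule summable_on_comparison_test[OF sc]) (use mult_left_mono[OF Nle norm_ge_zero] mult_nonneg_nonneg[OF norm_ge_zero N0] in \<open>simp_all only: mult.commute[of "norm (c _)"]\<close>)
    then show ?thesis by (intro summable_on_SigmaI[OF nrm]) auto
  qed
  have outer: "((\<lambda>j. (1 - s) powr (- a) / (1 - s) ^ sum j UNIV * P j) has_sum erdelyi_laguerre_gf \<alpha> x z) UNIV"
  proof -
    define c where "c r = (1 - s) powr (- a) * (1 / (1 - s)) ^ r" for r
    have e: "c r * u ^ r / fact r = (1 - s) powr (- a) * ((u / (1 - s)) ^ r /\<^sub>R fact r)" for r u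
      by (simp add: c_def scaleR_conv_of_real field_simps)
    have "((\<lambda>j. c (sum j UNIV) * (\<Prod>i\<in>UNIV. w i ^ j i / fact (j i))) has_sum
           (\<Sum>r. c r * (\<Sum>i\<in>UNIV. w i) ^ r / fact r)) UNIV"
    proof (rule has_sum_degree)
      let ?T = "\<Sum>i\<in>UNIV. norm (w i)"
      have "summable (\<lambda>r. norm ((1 - s) powr (- a)) * ((?T / norm (1 - s)) ^ r /\<^sub>R fact r))"
        by (intro summable_mult summable_exp_generic)
      also have "(\<lambda>r. norm ((1 - s) powr (- a)) * ((?T / norm (1 - s)) ^ r /\<^sub>R fact r)) =
          (\<lambda>r. norm (c r) * ?T ^ r / fact r)"
        by (simp add: c_def fun_eq_iff field_simps norm_mult norm_power norm_divide)
      finally show "summable (\<lambda>r. norm (c r) * ?T ^ r / fact r)" .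
    qed
    also have "(\<Sum>r. c r * (\<Sum>i\<in>UNIV. w i) ^ r / fact r) = (1 - s) powr (- a) * exp ((\<Sum>i\<in>UNIV. w i) / (1 - s))"
      unfolding e exp_def by (rule suminf_mult[OF summable_exp_generic])
    also have "\<dots> = erdelyi_laguerre_gf \<alpha> x z"
      by (simp add: erdelyi_laguerre_gf_def a_def s_def w_def sum_negf)
    finally show ?thesis by (simp add: c_def P_def power_one_over)
  qed
  have tot: "(f has_sum erdelyi_laguerre_gf \<alpha> x z) (UNIV \<times> UNIV)"
    by (rule has_sum_SigmaI[OF i1 outer abs_summable_summable[OF summ]])
  let ?J = "\<lambda>n :: 'k \<Rightarrow> nat. {j. \<forall>i. j i \<le> n i}"
  have fin: "finite (?J n)" for n
  proof -
    have "?J n = PiE UNIV (\<lambda>i. {..n i})" by auto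
    then show ?thesis by (simp add: finite_PiE)
  qed
  let ?g = "\<lambda>(n, j). (j, \<lambda>i. n i - j i)"
  have bij: "bij_betw ?g (SIGMA n:UNIV. ?J n) (UNIV \<times> UNIV)"
    by (rule bij_betw_byWitness[where f' = "\<lambda>(j, l). (\<lambda>i. j i + l i, j)"]) auto
  have "((\<lambda>p. f (?g p)) has_sum erdelyi_laguerre_gf \<alpha> x z) (SIGMA n:UNIV. ?J n)"
    using tot by (subst has_sum_reindex_bij_betw[OF bij])
  then show ?thesis
  proof (rule has_sum_SigmaD)
    fix n :: "'k \<Rightarrow> nat"
    have "f (?g (n, j)) = of_real (pochhammer (\<alpha> + 1 + real (sum j UNIV)) (sum n UNIV - sum j UNIV) *
     (\<Prod>i\<in>UNIV. (- (x $ i)) ^ j i / (fact (j i) * fact (n i - j i)))) * (\<Prod>i\<in>UNIV. z $ i ^ n i)"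
      if j: "j \<in> ?J n" for j
    proof -
      have *: "(\<Sum>i\<in>UNIV. n i - j i) = sum n UNIV - sum j UNIV"
        using j by (intro sum_subtractf_nat) auto
      have "P j * (\<Prod>i\<in>UNIV. z $ i ^ (n i - j i) / fact (n i - j i)) =
        (\<Prod>i\<in>UNIV. ((- of_real (x $ i)) ^ j i / (fact (j i) * fact (n i - j i))) * z $ i ^ n i)"
        unfolding P_def prod.distrib[symmetric]
      proof (rule prod.cong[OF refl])
        fix i
        have "z $ i ^ n i = z $ i ^ j i * z $ i ^ (n i - j i)"
          using j by (simp add: power_add[symmetric])
        moreover have "w i ^ j i = (- of_real (x $ i)) ^ j i * z $ i ^ j i"
          unfolding w_def by (simp add: power_mult_distrib[symmetric])
        ultimately show "w i ^ j i / fact (j i) * (z $ i ^ (n i - j i) / fact (n i - j i)) =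
          ((- of_real (x $ i)) ^ j i / (fact (j i) * fact (n i - j i))) * z $ i ^ n i" by simp
      qed
      note this[unfolded prod.distrib]
      moreover have "pochhammer (a + of_nat (sum j UNIV)) m = of_real (pochhammer (\<alpha> + 1 + real (sum j UNIV)) m)" for m
        unfolding a_def pochhammer_of_real[symmetric] by simp
      ultimately show ?thesis
        by (simp add: f_def * prod.distrib mult_ac del: of_nat_sum)
    qed
    then show "((\<lambda>j. f (?g (n, j))) has_sum of_real (laguerre_coeff \<alpha> x n) * (\<Prod>i\<in>UNIV. z $ i ^ n i)) (?J n)"
      using fin unfolding laguerre_coeff_def
      by (intro has_sum_finiteI) (auto simp: sum_distrib_right of_real_sum simp del: of_nat_sum)
  qed
qed

lemma laguerre_coeff_unique:
  fixes x :: "real ^ 'k::finite"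
  assumes "\<And>z :: complex ^ 'k. (\<Sum>i\<in>UNIV. norm (z $ i)) < 1 \<Longrightarrow>
        ((\<lambda>m. of_real (L m) * (\<Prod>i\<in>UNIV. z $ i ^ m i)) has_sum erdelyi_laguerre_gf \<alpha> x z) UNIV"
  shows "L = laguerre_coeff \<alpha> x"
proof
  fix n
  let ?\<epsilon> = "1 / (2 * real CARD('k))"
  let ?d = "\<lambda>n. complex_of_real (L n - laguerre_coeff \<alpha> x n)"
  have "?d n = 0"
  proof (rule multi_powser_zero[of "UNIV :: 'k set" ?\<epsilon> ?d])
    fix y :: "'k \<Rightarrow> complex" assume y: "\<And>i. i \<in> UNIV \<Longrightarrow> norm (y i) < ?\<epsilon>"
    have "(\<Sum>i\<in>UNIV. norm (y i)) \<le> of_nat (card (UNIV :: 'k set)) * ?\<epsilon>"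
      using y by (intro sum_bounded_above) (auto intro: less_imp_le)
    then have 1: "(\<Sum>i\<in>UNIV. norm ((\<chi> i. y i) $ i)) < 1" by simp
    show "((\<lambda>n. ?d n * (\<Prod>i\<in>UNIV. y i ^ n i)) has_sum 0) (UNIV \<rightarrow>\<^sub>E UNIV)"
      using has_sum_add[OF assms[OF 1] has_sum_uminusI[OF has_sum_laguerre_coeff[OF 1, of \<alpha> x]]]
      by (simp add: algebra_simps)
  qed (auto simp: PiE_UNIV_domain)
  then show "L n = laguerre_coeff \<alpha> x n" by simp
qed

lemma erdelyi_laguerre_eq_laguerre_coeff: "erdelyi_laguerre \<alpha> n x = laguerre_coeff \<alpha> x n"
proof -
  have "(THE L. \<forall>z :: complex ^ 'a. (\<Sum>i\<in>UNIV. norm (z $ i)) < 1 \<longrightarrow>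
        ((\<lambda>m. of_real (L m) * (\<Prod>i\<in>UNIV. z $ i ^ m i)) has_sum erdelyi_laguerre_gf \<alpha> x z)
          (UNIV :: ('a \<Rightarrow> nat) set)) = laguerre_coeff \<alpha> x"
    using has_sum_laguerre_coeff by (intro the_equality laguerre_coeff_unique) auto
  then show ?thesis by (simp add: erdelyi_laguerre_def)
qed

lemma has_sum_erdelyi_laguerre:
  fixes z :: "complex ^ 'k::finite"
  assumes "(\<Sum>i\<in>UNIV. norm (z $ i)) < 1"
  shows "((\<lambda>n. of_real (erdelyi_laguerre \<alpha> n x) * (\<Prod>i\<in>UNIV. z $ i ^ n i)) has_sum erdelyi_laguerre_gf \<alpha> x z) UNIV"
  unfolding erdelyi_laguerre_eq_laguerre_coeff by (rule has_sum_laguerre_coeff[OF assms])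

lemma erdelyi_laguerre_eqI:
  fixes x :: "real ^ 'k::finite"
  assumes "\<And>z :: complex ^ 'k. (\<Sum>i\<in>UNIV. norm (z $ i)) < 1 \<Longrightarrow>
        ((\<lambda>m. of_real (L m) * (\<Prod>i\<in>UNIV. z $ i ^ m i)) has_sum erdelyi_laguerre_gf \<alpha> x z) UNIV"
  shows "erdelyi_laguerre \<alpha> n x = L n"
  unfolding erdelyi_laguerre_eq_laguerre_coeff using laguerre_coeff_unique[OF assms] by simp

lemma erdelyi_laguerre_Phi2:
  fixes x :: "real ^ 'k::finite"
  assumes "\<alpha> > -1"
  shows "erdelyi_laguerre \<alpha> n x =
    pochhammer (\<alpha> + 1) (sum n UNIV) / (\<Prod>i\<in>UNIV. fact (n i)) *
    (\<Sum>j | \<forall>i. j i \<le> n i. (\<Prod>i\<in>UNIV. pochhammer (- real (n i)) (j i)) / pochhammer (\<alpha> + 1) (sum j UNIV) *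
        (\<Prod>i\<in>UNIV. x $ i ^ j i / fact (j i)))"
  unfolding erdelyi_laguerre_eq_laguerre_coeff laguerre_coeff_def sum_distrib_left
proof (rule sum.cong[OF refl])
  fix j assume j: "j \<in> {j. \<forall>i. j i \<le> n i}"
  have le: "sum j UNIV \<le> sum n UNIV" using j by (intro sum_mono) auto
  have "pochhammer (\<alpha> + 1) (sum j UNIV) > 0" using assms by (intro pochhammer_pos) auto
  moreover have "pochhammer (\<alpha> + 1) (sum n UNIV) = pochhammer (\<alpha> + 1) (sum j UNIV) *
      pochhammer (\<alpha> + 1 + real (sum j UNIV)) (sum n UNIV - sum j UNIV)"
    by (rule pochhammer_product[OF le])
  moreover have "(\<Prod>i\<in>UNIV. (- (x $ i)) ^ j i / (fact (j i) * fact (n i - j i))) =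
     (\<Prod>i\<in>UNIV. pochhammer (- real (n i)) (j i)) * (\<Prod>i\<in>UNIV. x $ i ^ j i / fact (j i)) / (\<Prod>i\<in>UNIV. fact (n i))"
    unfolding prod.distrib[symmetric] prod_dividef[symmetric]
  proof (rule prod.cong[OF refl])
    fix i
    have "real (n i choose j i) = (- 1) ^ j i * pochhammer (- real (n i)) (j i) / fact (j i)"
      by (simp add: binomial_gbinomial gbinomial_pochhammer)
    moreover have "real (n i choose j i) = fact (n i) / (fact (j i) * fact (n i - j i))"
      using j by (intro binomial_fact) auto
    ultimately have "(- 1) ^ j i * pochhammer (- real (n i)) (j i) = fact (n i) / fact (n i - j i)"
      by (simp add: field_simps)
    then have "(- 1) ^ j i * ((- 1) ^ j i * pochhammer (- real (n i)) (j i)) = (- 1) ^ j i * (fact (n i) / fact (n i - j i))"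
      by simp
    then have "pochhammer (- real (n i)) (j i) = (- 1) ^ j i * fact (n i) / fact (n i - j i)"
      by (simp add: mult.assoc[symmetric] power_mult_distrib[symmetric])
    moreover have "(- (x $ i)) ^ j i = (- 1) ^ j i * x $ i ^ j i"
      by (simp add: power_mult_distrib[symmetric])
    ultimately show "(- (x $ i)) ^ j i / (fact (j i) * fact (n i - j i)) =
       pochhammer (- real (n i)) (j i) * (x $ i ^ j i / fact (j i)) / fact (n i)"
      by simp
  qed
  ultimately show "pochhammer (\<alpha> + 1 + real (sum j UNIV)) (sum n UNIV - sum j UNIV) *
      (\<Prod>i\<in>UNIV. (- (x $ i)) ^ j i / (fact (j i) * fact (n i - j i))) =
    pochhammer (\<alpha> + 1) (sum n UNIV) / (\<Prod>i\<in>UNIV. fact (n i)) *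
    ((\<Prod>i\<in>UNIV. pochhammer (- real (n i)) (j i)) / pochhammer (\<alpha> + 1) (sum j UNIV) *
        (\<Prod>i\<in>UNIV. x $ i ^ j i / fact (j i)))"
    by simp
qed

end

theory Submission
  imports Defs
begin

text \<open>
  Let \<open>\<Lambda>\<^sub>c\<close> be the linear functional on polynomials in \<open>t\<close> with \<open>\<Lambda>\<^sub>c(t\<^sup>j) = 1 / (c)\<^sub>j\<close>. Then
  \<open>\<Phi>\<^sub>2[-n; c; x] = \<Lambda>\<^sub>c(\<Prod>i. (1 - x\<^sub>i t) ^ n\<^sub>i)\<close>, which is affine in each root parameter separately. Hence
  for parameters in \<open>[0, X]\<close> its modulus is largest at a vertex of the box, where it is
  \<open>|\<Lambda>\<^sub>c((1 - X t) ^ m)| = |\<^sub>1F\<^sub>1(-m; c; X)|\<close>, so the one-variable bound \<open>exp (X / 2)\<close> for \<open>c \<ge> 1\<close>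
  suffices. For \<open>c > 1\<close> it follows from \<open>c = 1\<close>, and for \<open>c = 1\<close> it expresses that a single term of
  the squared Charlier norm \<open>\<Sum>k. a ^ k / k! * C\<^sub>m(k)\<^sup>2 = a ^ m * m! * exp a\<close> is at most the whole sum,
  since \<open>C\<^sub>m(m)\<close> is a multiple of \<open>L\<^sub>m(a)\<close>. As \<open>(1 / k)\<^sub>n \<le> n!\<close>, this is stronger than required.
\<close>

section \<open>Charlier polynomials and the classical Laguerre bound\<close>

text \<open>
  The normalisation \<open>a ^ m * C\<^sub>m(k; a)\<close> makes sense for \<open>a = 0\<close>. The recursion is applied with
  \<open>k - 1\<close> truncated at \<open>k = 0\<close>, where the factor \<open>k\<close> makes the value irrelevant.
\<close>

fun charlier :: "real \<Rightarrow> nat \<Rightarrow> nat \<Rightarrow> real" where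
  "charlier a 0 k = 1"
| "charlier a (Suc m) k = a * charlier a m k - real k * charlier a m (k - 1)"

text \<open>Lowering relation, needed for the adjointness argument below. In the induction the
  forward difference also acts on the factor \<open>k\<close> of the recursion, which contributes
  the extra \<open>- charlier a (Suc m) k\<close>.\<close>

lemma charlier_diff:
  "charlier a (Suc m) (Suc k) - charlier a (Suc m) k = - real (Suc m) * charlier a m k"
proof (induction m arbitrary: k)
  case 0
  show ?case by simp
next
  case (Suc m)
  have "real k * (charlier a (Suc m) k - charlier a (Suc m) (k - 1)) =
      - real (Suc m) * (real k * charlier a m (k - 1))"
    using Suc[of "k - 1"] by (cases k) auto
  moreover have "charlier a (Suc (Suc m)) (Suc k) - charlier a (Suc (Suc m)) k =
      a * (charlier a (Suc m) (Suc k) - charlier a (Suc m) k) - charlier a (Suc m) k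
      - real k * (charlier a (Suc m) k - charlier a (Suc m) (k - 1))"
    unfolding charlier.simps(2)[of a "Suc m"] by (simp add: algebra_simps)
  ultimately show ?case
    unfolding Suc by (simp add: algebra_simps)
qed

text \<open>\<open>fact j * real (k choose j)\<close> is a falling factorial of \<open>k\<close>;
  multiplying the one for \<open>k - 1\<close> by \<open>k\<close> lengthens it by one factor, and
  Pascal's rule does the rest.\<close>

lemma charlier_eq_sum:
  "charlier a m k =
    (\<Sum>j\<le>m. real (m choose j) * ((- 1) ^ j * a ^ (m - j) * (fact j * real (k choose j))))"
proof (induction m arbitrary: k)
  case 0
  show ?case by simp
next
  case (Suc m)
  let ?h = "\<lambda>j. (- 1) ^ j * a ^ (Suc m - j) * (fact j * real (k choose j))"
  have shift: "real k * (fact j * real (k - 1 choose j)) = fact (Suc j) * real (k choose Suc j)" for j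
  proof (cases k)
    case (Suc l)
    then show ?thesis
      using arg_cong[OF Suc_times_binomial_eq[of l j], of real] by (simp add: algebra_simps)
  qed simp
  have "a * charlier a m k = (\<Sum>j\<le>m. real (m choose j) * ?h j)"
    unfolding Suc sum_distrib_left by (intro sum.cong refl) (simp add: Suc_diff_le)
  also have "\<dots> = (\<Sum>j\<le>Suc m. real (m choose j) * ?h j)"
    by simp
  also have "\<dots> = ?h 0 + (\<Sum>j\<le>m. real (m choose Suc j) * ?h (Suc j))"
    by (subst sum.atMost_Suc_shift) simp
  finally have 1: "a * charlier a m k = ?h 0 + (\<Sum>j\<le>m. real (m choose Suc j) * ?h (Suc j))" .
  have "real k * charlier a m (k - 1) = (\<Sum>j\<le>m. real (m choose j) *
      ((- 1) ^ j * a ^ (m - j) * (real k * (fact j * real (k - 1 choose j)))))"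
    unfolding Suc sum_distrib_left by (intro sum.cong refl) (simp only: mult_ac)
  also have "\<dots> = (\<Sum>j\<le>m. - (real (m choose j) * ?h (Suc j)))"
    unfolding shift by (intro sum.cong refl) simp
  finally have 2: "real k * charlier a m (k - 1) = (\<Sum>j\<le>m. - (real (m choose j) * ?h (Suc j)))" .
  have "(\<Sum>j\<le>Suc m. real (Suc m choose j) * ?h j) =
      ?h 0 + (\<Sum>j\<le>m. real (Suc m choose Suc j) * ?h (Suc j))"
    by (subst sum.atMost_Suc_shift) simp
  also have "\<dots> = ?h 0 + (\<Sum>j\<le>m. real (m choose Suc j) * ?h (Suc j)) -
      (\<Sum>j\<le>m. - (real (m choose j) * ?h (Suc j)))"
    unfolding add_diff_eq[symmetric] sum_subtractf[symmetric]
    by (intro arg_cong2[where f = "(+)"] sum.cong refl) (simp add: algebra_simps)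
  finally show ?case using 1 2 by simp
qed

lemma abs_charlier_le:
  assumes "a \<ge> 0"
  shows "\<bar>charlier a m k\<bar> \<le> (a + real k) ^ m"
proof (induction m arbitrary: k)
  case 0
  show ?case by simp
next
  case (Suc m)
  have "\<bar>charlier a m (k - 1)\<bar> \<le> (a + real k) ^ m"
    using Suc[of "k - 1"] power_mono[of "a + real (k - 1)" "a + real k" m] assms by simp
  then have "a * \<bar>charlier a m k\<bar> + real k * \<bar>charlier a m (k - 1)\<bar> \<le> a * (a + real k) ^ m + real k * (a + real k) ^ m"
    using Suc[of k] assms by (intro add_mono mult_left_mono) auto
  moreover have "\<bar>charlier a (Suc m) k\<bar> \<le> a * \<bar>charlier a m k\<bar> + real k * \<bar>charlier a m (k - 1)\<bar>"
    using abs_triangle_ineq4[of "a * charlier a m k" "real k * charlier a m (k - 1)"] assms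
    by (simp add: abs_mult)
  ultimately show ?case by (simp add: algebra_simps)
qed

lemma summable_charlier_product:
  assumes "a \<ge> 0"
  shows "summable (\<lambda>k. a ^ k / fact k * (charlier a m k * charlier a l k))"
proof (rule summable_comparison_test)
  \<comment> \<open>Since \<open>a + k \<le> exp (a + k)\<close>, the growth
    \<open>(a + k) ^ (m + l)\<close> is at most \<open>?B powr a * ?B ^ k\<close>, so an exponential
    series in \<open>a * ?B\<close> dominates.\<close>
  let ?B = "exp (real (m + l))"
  show "summable (\<lambda>k. ?B powr a * ((a * ?B) ^ k /\<^sub>R fact k))"
    by (intro summable_mult summable_exp_generic)
  have "norm (a ^ k / fact k * (charlier a m k * charlier a l k)) \<le> ?B powr a * ((a * ?B) ^ k /\<^sub>R fact k)" for k
  proof -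
    have "\<bar>charlier a m k * charlier a l k\<bar> \<le> (a + real k) ^ (m + l)"
      unfolding abs_mult power_add using assms by (intro mult_mono abs_charlier_le) auto
    also have "\<dots> \<le> exp (a + real k) ^ (m + l)"
      using assms exp_ge_add_one_self[of "a + real k"] by (intro power_mono) linarith+
    also have "\<dots> = ?B powr a * ?B ^ k"
      by (simp add: powr_def exp_add[symmetric] exp_of_nat_mult[symmetric] algebra_simps)
    finally have "a ^ k / fact k * \<bar>charlier a m k * charlier a l k\<bar> \<le> a ^ k / fact k * (?B powr a * ?B ^ k)"
      using assms by (intro mult_left_mono) auto
    then show ?thesis
      using assms by (simp add: abs_mult power_mult_distrib field_simps)
  qed
  then show "\<exists>N. \<forall>k\<ge>N. norm (a ^ k / fact k * (charlier a m k * charlier a l k)) \<le> ?B powr a * ((a * ?B) ^ k /\<^sub>R fact k)"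
    by blast
qed

text \<open>
  With respect to the weight \<open>a ^ k / k!\<close>, multiplication by \<open>k\<close> after a backward shift is adjoint to
  \<open>a\<close> times the forward shift, so the recursion in \<open>m\<close> is adjoint to \<open>- a\<close> times the forward difference.
\<close>

lemma charlier_norm_sums:
  assumes "a \<ge> 0"
  shows "(\<lambda>k. a ^ k / fact k * (charlier a m k)\<^sup>2) sums (a ^ m * fact m * exp a)"
proof (induction m)
  case 0
  show ?case using exp_converges[of a] by (simp add: field_simps)
next
  case (Suc m)
  let ?S = "a ^ m * fact m * exp a"
  let ?u = "\<lambda>k. a ^ k / fact k * (charlier a m k * charlier a (Suc m) k)"
  let ?v = "\<lambda>k. a ^ k / fact k * (real k * charlier a m (k - 1) * charlier a (Suc m) k)"
  have u: "(\<lambda>k. a * ?u k) sums (a * suminf ?u)"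
    by (intro sums_mult summable_sums summable_charlier_product assms)
  have "?v (Suc k) = a * ?u k - a * real (Suc m) * (a ^ k / fact k * (charlier a m k)\<^sup>2)" for k
  proof -
    have 1: "charlier a (Suc m) (Suc k) = charlier a (Suc m) k - real (Suc m) * charlier a m k"
      using charlier_diff[of a m k] by linarith
    have 2: "a ^ Suc k / fact (Suc k) * (real (Suc k) * b * c) = a * (a ^ k / fact k * (b * c))" for b c
      by (simp add: divide_simps del: of_nat_Suc)
    show ?thesis
      unfolding diff_Suc_1 2 unfolding 1 power2_eq_square right_diff_distrib by (simp only: mult_ac)
  qed
  then have "(\<lambda>k. ?v (Suc k)) sums (a * suminf ?u - a * real (Suc m) * ?S)"
    using sums_diff[OF u sums_mult[OF Suc, of "a * real (Suc m)"]] by presburger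
  \<comment> \<open>The term of \<open>?v\<close> at 0 vanishes, so the index shift leaves the sum
    unchanged.\<close>
  then have "?v sums (a * suminf ?u - a * real (Suc m) * ?S)"
    by (subst (asm) sums_Suc_iff) simp
  from sums_diff[OF u this]
  have "(\<lambda>k. a * ?u k - ?v k) sums (a * real (Suc m) * ?S)" by simp
  moreover have "a * ?u k - ?v k = a ^ k / fact k * (charlier a (Suc m) k)\<^sup>2" for k
  proof -
    have "a ^ k / fact k * (charlier a (Suc m) k)\<^sup>2 = a ^ k / fact k *
        ((a * charlier a m k - real k * charlier a m (k - 1)) * charlier a (Suc m) k)"
      unfolding power2_eq_square charlier.simps(2)[symmetric] ..
    then show ?thesis by (simp only: left_diff_distrib right_diff_distrib mult_ac)
  qed
  ultimately show ?case by (simp add: algebra_simps)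
qed

lemma abs_laguerre_le:
  fixes a :: real
  assumes "a \<ge> 0"
  shows "\<bar>\<Sum>j\<le>m. real (m choose j) * (- a) ^ j / fact j\<bar> \<le> exp (a / 2)"
proof (cases "a = 0")
  case True
  have "(\<Sum>j\<le>m. real (m choose j) * (- a) ^ j / fact j) = (\<Sum>j\<le>m. if j = 0 then 1 else 0)"
    using True by (intro sum.cong) auto
  then show ?thesis using True by simp
next
  case False
  then have a: "a > 0" using assms by simp
  let ?L = "\<Sum>j\<le>m. real (m choose j) * (- a) ^ j / fact j"
  have "charlier a m m = (\<Sum>j\<le>m. (- 1) ^ m * fact m * (real (m choose j) * (- a) ^ j / fact j))"
    unfolding charlier_eq_sum
  proof (rule sum.reindex_bij_witness[where i = "\<lambda>j. m - j" and j = "\<lambda>j. m - j"])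
    fix j assume j: "j \<in> {..m}"
    have "(- 1 :: real) ^ m * (- 1) ^ (m - j) = (- 1) ^ j"
      using j by (simp add: power_add[symmetric] minus_one_power_iff)
    moreover have "(- a) ^ (m - j) = (- 1) ^ (m - j) * a ^ (m - j)"
      by (rule power_minus)
    moreover have "fact j * real (m choose j) = fact m / fact (m - j)"
      using j by (simp add: binomial_fact)
    ultimately show "(- 1) ^ m * fact m * (real (m choose (m - j)) * (- a) ^ (m - j) / fact (m - j)) =
        real (m choose j) * ((- 1) ^ j * a ^ (m - j) * (fact j * real (m choose j)))"
      using j by (simp add: binomial_symmetric[symmetric])
  qed auto
  then have "charlier a m m = (- 1) ^ m * fact m * ?L"
    by (simp only: sum_distrib_left)
  then have "(charlier a m m)\<^sup>2 = (fact m)\<^sup>2 * ?L\<^sup>2"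
    by (simp add: power_mult_distrib power_mult[symmetric])
  moreover have "a ^ m / fact m * (charlier a m m)\<^sup>2 \<le> a ^ m * fact m * exp a"
    using sum_le_suminf[OF sums_summable[OF charlier_norm_sums[OF assms, of m]], of "{m}"]
      sums_unique[OF charlier_norm_sums[OF assms, of m]] a by simp
  ultimately have "(a ^ m * fact m) * ?L\<^sup>2 \<le> (a ^ m * fact m) * exp a"
    by (simp add: power2_eq_square mult_ac)
  \<comment> \<open>Cancelling \<open>a ^ m\<close> is what required splitting off
    \<open>a = 0\<close>.\<close>
  then have "?L\<^sup>2 \<le> exp a" using a by simp
  also have "\<dots> = (exp (a / 2))\<^sup>2" by (simp add: exp_double[symmetric])
  finally show ?thesis using abs_le_square_iff[of ?L "exp (a / 2)"] by simp
qed

text \<open>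
  The coefficients of the expansion \<open>L\<^sub>m\<^sup>c\<^sup>-\<^sup>1 = (\<Sum>j\<le>m. (c - 1)\<^sub>m\<^sub>-\<^sub>j / (m - j)! * L\<^sub>j)\<close> are nonnegative and sum to
  \<open>(c)\<^sub>m / m!\<close>, so the bound passes from \<open>c = 1\<close> to \<open>c \<ge> 1\<close>.
\<close>

lemma abs_confluent_le:
  fixes a c :: real
  assumes "a \<ge> 0" "c \<ge> 1"
  shows "\<bar>\<Sum>i\<le>m. real (m choose i) * (- a) ^ i / pochhammer c i\<bar> \<le> exp (a / 2)"
proof -
  \<comment> \<open>\<open>?w j\<close> is \<open>fact m\<close> times the expansion coefficient of
    \<open>L\<^sub>j\<close>.\<close>
  let ?w = "\<lambda>j. real (m choose j) * (pochhammer (c - 1) (m - j) * fact j)"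
  let ?F = "\<Sum>i\<le>m. real (m choose i) * (- a) ^ i / pochhammer c i"
  have poch_pos: "pochhammer c i > 0" for i
    using assms by (intro pochhammer_pos) auto
  \<comment> \<open>Comparison of the coefficients of \<open>(- a) ^ i\<close>. Pulling out
    \<open>m choose i\<close> leaves Vandermonde's identity for rising factorials with parameters
    \<open>1 + i\<close> and \<open>c - 1\<close>; the case \<open>i = 0\<close> gives the total
    weight.\<close>
  have vandermonde: "(\<Sum>j\<le>m. ?w j * real (j choose i) / fact i) = pochhammer c m * real (m choose i) / pochhammer c i"
    if i: "i \<le> m" for i
  proof -
    have "(\<Sum>j\<le>m. ?w j * real (j choose i) / fact i) = (\<Sum>j\<in>{i..m}. ?w j * real (j choose i) / fact i)"
      by (intro sum.mono_neutral_right) auto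
    also have "\<dots> = (\<Sum>l\<le>m - i. real (m choose i) * (real (m - i choose l) * pochhammer (1 + real i) l * pochhammer (c - 1) (m - i - l)))"
    proof (rule sum.reindex_bij_witness[where i = "\<lambda>l. l + i" and j = "\<lambda>j. j - i"])
      fix j assume j: "j \<in> {i..m}"
      have "(m choose j) * (j choose i) = (m choose i) * (m - i choose (j - i))"
        using j by (intro choose_mult) auto
      then have 1: "real (m choose j) * real (j choose i) = real (m choose i) * real (m - i choose (j - i))"
        by (metis of_nat_mult)
      have "pochhammer 1 j = pochhammer (1 :: real) i * pochhammer (1 + real i) (j - i)"
        using j by (intro pochhammer_product) auto
      then have 2: "(fact j :: real) = fact i * pochhammer (1 + real i) (j - i)"
        by (simp add: pochhammer_fact)
      show "real (m choose i) * (real (m - i choose (j - i)) * pochhammer (1 + real i) (j - i) * pochhammer (c - 1) (m - i - (j - i)))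
          = ?w j * real (j choose i) / fact i"
        using j 1 2 by simp
    qed (use i in auto)
    also have "\<dots> = real (m choose i) * pochhammer (c + real i) (m - i)"
      using pochhammer_binomial_sum[of "1 + real i" "c - 1" "m - i"]
      by (simp add: sum_distrib_left algebra_simps)
    also have "\<dots> = pochhammer c m * real (m choose i) / pochhammer c i"
      using pochhammer_product[OF i, of c] poch_pos[of i] by simp
    finally show ?thesis .
  qed
  have total: "(\<Sum>j\<le>m. ?w j) = pochhammer c m"
    using vandermonde[of 0] by simp
  have w: "?w j \<ge> 0" for j
    using assms by (auto simp: pochhammer_prod intro!: mult_nonneg_nonneg prod_nonneg)
  have "pochhammer c m * ?F = (\<Sum>i\<le>m. (- a) ^ i * (\<Sum>j\<le>m. ?w j * real (j choose i) / fact i))"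
    unfolding sum_distrib_left[of "pochhammer c m"] by (intro sum.cong refl) (subst vandermonde, simp_all)
  also have "\<dots> = (\<Sum>j\<le>m. ?w j * (\<Sum>i\<le>m. real (j choose i) * (- a) ^ i / fact i))"
    unfolding sum_distrib_left by (subst sum.swap) (intro sum.cong refl, simp)
  also have "\<dots> = (\<Sum>j\<le>m. ?w j * (\<Sum>i\<le>j. real (j choose i) * (- a) ^ i / fact i))"
    by (intro sum.cong refl arg_cong2[where f = "(*)"] sum.mono_neutral_right) auto
  also have "\<bar>\<dots>\<bar> \<le> (\<Sum>j\<le>m. ?w j * exp (a / 2))"
    by (intro order.trans[OF sum_abs] sum_mono, subst abs_mult, subst abs_of_nonneg[OF w])
      (rule mult_left_mono[OF abs_laguerre_le[OF assms(1)] w])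
  also have "\<dots> = pochhammer c m * exp (a / 2)"
    unfolding sum_distrib_right[symmetric] total ..
  finally show ?thesis
    using poch_pos[of m] by (simp add: abs_mult)
qed

section \<open>The functional with moments 1/(c)_j\<close>

definition inverse_pochhammer_functional :: "real \<Rightarrow> real poly \<Rightarrow> real" where
  "inverse_pochhammer_functional c p = (\<Sum>j\<le>degree p. coeff p j / pochhammer c j)"

text \<open>Padding with zero coefficients gives polynomials of different degrees a common summation
  range, from which linearity follows.\<close>

lemma inverse_pochhammer_functional_eq:
  assumes "degree p \<le> N"
  shows "inverse_pochhammer_functional c p = (\<Sum>j\<le>N. coeff p j / pochhammer c j)"
  unfolding inverse_pochhammer_functional_def
  using assms by (intro sum.mono_neutral_left) (auto simp: coeff_eq_0)

lemma inverse_pochhammer_functional_add: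
  "inverse_pochhammer_functional c (p + q) =
    inverse_pochhammer_functional c p + inverse_pochhammer_functional c q"
proof -
  let ?N = "max (degree p) (degree q)"
  show ?thesis
    using degree_add_le_max[of p q]
    by (simp add: inverse_pochhammer_functional_eq[of _ ?N] sum.distrib add_divide_distrib)
qed

lemma inverse_pochhammer_functional_smult:
  "inverse_pochhammer_functional c (smult b p) = b * inverse_pochhammer_functional c p"
  by (simp add: inverse_pochhammer_functional_eq[of _ "degree p"] degree_smult_le sum_distrib_left)

lemma inverse_pochhammer_functional_monom:
  "inverse_pochhammer_functional c (monom b j) = b / pochhammer c j"
proof -
  have "inverse_pochhammer_functional c (monom b j) = (\<Sum>i\<le>j. if i = j then b / pochhammer c j else 0)"
    unfolding inverse_pochhammer_functional_eq[OF degree_monom_le] by (intro sum.cong) auto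
  then show ?thesis by simp
qed

lemma inverse_pochhammer_functional_sum:
  "inverse_pochhammer_functional c (\<Sum>i\<in>A. f i) = (\<Sum>i\<in>A. inverse_pochhammer_functional c (f i))"
proof (induction A rule: infinite_finite_induct)
  case (infinite A)
  then show ?case by (simp add: inverse_pochhammer_functional_def)
next
  case empty
  then show ?case by (simp add: inverse_pochhammer_functional_def)
qed (simp add: inverse_pochhammer_functional_add)

lemma linear_poly_power_eq_sum:
  fixes y :: "'a::comm_ring_1"
  shows "[:1, - y:] ^ m = (\<Sum>j\<le>m. monom (of_nat (m choose j) * (- y) ^ j) j)"
proof -
  have "[:1, - y:] = monom (- y) 1 + 1"
    by (simp add: monom_altdef one_pCons)
  then show ?thesis
    by (simp add: binomial_ring monom_power of_nat_monom mult_monom)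
qed

lemma abs_inverse_pochhammer_functional_le:
  assumes "c \<ge> 1" "finite A" "\<And>i. i \<in> A \<Longrightarrow> 0 \<le> x i \<and> x i \<le> X" "X \<ge> 0"
  shows "\<bar>inverse_pochhammer_functional c (\<Prod>i\<in>A. [:1, - x i:] ^ n i)\<bar> \<le> exp (X / 2)"
proof -
  \<comment> \<open>Quantifying over every exponent \<open>m\<close> makes the induction work:
    \<open>1 - y t\<close> is a convex combination of \<open>1\<close> and \<open>1 - X t\<close>,
    and the second option raises \<open>m\<close> by one.\<close>
  define good where "good p \<longleftrightarrow>
    (\<forall>m. \<bar>inverse_pochhammer_functional c (p * [:1, - X:] ^ m)\<bar> \<le> exp (X / 2))" for p
  have good_1: "good 1"
    unfolding good_def
    by (simp add: linear_poly_power_eq_sum inverse_pochhammer_functional_sum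
        inverse_pochhammer_functional_monom abs_confluent_le assms)
  have good_mult: "good (p * [:1, - y:])" if p: "good p" and y: "0 \<le> y" "y \<le> X" for p y
    unfolding good_def
  proof
    fix m
    let ?F = "\<lambda>m. inverse_pochhammer_functional c (p * [:1, - X:] ^ m)"
    \<comment> \<open>If \<open>X = 0\<close>, then \<open>y = 0\<close> and the convention
      \<open>y / 0 = 0\<close> still gives \<open>y = s * X\<close>.\<close>
    define s where "s = y / X"
    have s: "0 \<le> s" "s \<le> 1" "y = s * X"
      using y by (auto simp: s_def divide_simps)
    have "[:1, - y:] = smult (1 - s) 1 + smult s [:1, - X:]"
      by (simp add: s(3) one_pCons)
    then have "p * [:1, - y:] * [:1, - X:] ^ m =
        smult (1 - s) (p * [:1, - X:] ^ m) + smult s (p * [:1, - X:] ^ Suc m)"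
      by (simp only: distrib_left distrib_right mult_smult_left mult_smult_right power_Suc mult_1 mult_1_right mult.assoc)
    then have "\<bar>inverse_pochhammer_functional c (p * [:1, - y:] * [:1, - X:] ^ m)\<bar> =
        \<bar>(1 - s) * ?F m + s * ?F (Suc m)\<bar>"
      by (simp only: inverse_pochhammer_functional_add inverse_pochhammer_functional_smult)
    also have "\<dots> \<le> (1 - s) * \<bar>?F m\<bar> + s * \<bar>?F (Suc m)\<bar>"
      using s abs_triangle_ineq[of "(1 - s) * ?F m" "s * ?F (Suc m)"] by (simp only: abs_mult)
    also have "\<dots> \<le> exp (X / 2)"
      using p s unfolding good_def by (intro convex_bound_le) (simp_all only: diff_ge_0_iff_ge diff_add_cancel)
    finally show "\<bar>inverse_pochhammer_functional c (p * [:1, - y:] * [:1, - X:] ^ m)\<bar> \<le> exp (X / 2)" .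
  qed
  have good_power: "good (p * [:1, - y:] ^ r)" if "good p" "0 \<le> y" "y \<le> X" for p y r
    using that(1)
  proof (induction r arbitrary: p)
    case (Suc r)
    then show ?case using Suc.IH[OF good_mult[OF Suc.prems that(2,3)]] by (simp only: power_Suc mult.assoc)
  qed simp
  have "good (\<Prod>i\<in>A. [:1, - x i:] ^ n i)"
    using assms(2,3)
  proof (induction A rule: finite_induct)
    case (insert i A)
    then show ?case using good_power[of "\<Prod>i\<in>A. [:1, - x i:] ^ n i" "x i" "n i"] by (simp add: mult.commute)
  qed (simp add: good_1)
  then have "\<bar>inverse_pochhammer_functional c ((\<Prod>i\<in>A. [:1, - x i:] ^ n i) * [:1, - X:] ^ 0)\<bar> \<le> exp (X / 2)"
    unfolding good_def by blast
  then show ?thesis by simp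
qed

section \<open>Application to the multivariate polynomials\<close>

lemma prod_monom: "(\<Prod>i\<in>A. monom (a i) (j i)) = monom (\<Prod>i\<in>A. a i) (\<Sum>i\<in>A. j i)"
  by (induction A rule: infinite_finite_induct) (auto simp: mult_monom one_pCons monom_0)

text \<open>Expanding the product gives one monomial of degree \<open>sum j UNIV\<close> per
  multi-index \<open>j\<close>, and \<open>(-r)_l / l!\<close> is the signed binomial
  coefficient.\<close>

lemma Phi2_eq_inverse_pochhammer_functional:
  fixes n :: "'k::finite \<Rightarrow> nat" and x :: "'k \<Rightarrow> real"
  shows "(\<Sum>j | \<forall>i. j i \<le> n i. (\<Prod>i\<in>UNIV. pochhammer (- real (n i)) (j i)) / pochhammer c (sum j UNIV) *
        (\<Prod>i\<in>UNIV. x i ^ j i / fact (j i))) =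
     inverse_pochhammer_functional c (\<Prod>i\<in>UNIV. [:1, - x i:] ^ n i)"
proof -
  have box: "PiE UNIV (\<lambda>i. {..n i}) = {j. \<forall>i. j i \<le> n i}" by auto
  have coef: "real (r choose l) * (- y) ^ l = pochhammer (- real r) l * (y ^ l / fact l)" for r l and y :: real
  proof -
    have "(- 1) ^ l * (- y) ^ l = y ^ l"
      by (simp add: power_mult_distrib[symmetric])
    then show ?thesis
      by (simp add: binomial_gbinomial gbinomial_pochhammer)
  qed
  have "(\<Prod>i\<in>UNIV. [:1, - x i:] ^ n i) =
      (\<Sum>j | \<forall>i. j i \<le> n i. \<Prod>i\<in>UNIV. monom (real (n i choose j i) * (- x i) ^ j i) (j i))"
    unfolding linear_poly_power_eq_sum by (subst prod_sum_PiE) (auto simp: box)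
  then show ?thesis
    by (simp add: prod_monom inverse_pochhammer_functional_sum inverse_pochhammer_functional_monom coef prod.distrib[symmetric])
qed

theorem theorem1p1:
  fixes n :: "'k :: finite \<Rightarrow> nat" and \<alpha> :: real and x :: "real ^ 'k"
  assumes "\<alpha> > 0"
    and "\<And>j. x $ j \<ge> 0"
  shows "\<bar>erdelyi_laguerre \<alpha> n x\<bar> \<le>
           2 ^ (CARD('k) - 1) *
           (pochhammer (\<alpha> + 1) (\<Sum>i\<in>UNIV. n i) /
            (\<Prod>i\<in>UNIV. pochhammer (1 / real CARD('k)) (n i))) *
           exp ((MAX j. \<bar>x $ j\<bar>) / 2)"
proof -
  let ?X = "MAX j. \<bar>x $ j\<bar>"
  let ?P = "pochhammer (\<alpha> + 1) (\<Sum>i\<in>UNIV. n i)"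
  let ?F = "inverse_pochhammer_functional (\<alpha> + 1) (\<Prod>i\<in>UNIV. [:1, - (x $ i):] ^ n i)"
  let ?Q = "\<Prod>i\<in>UNIV. pochhammer (1 / real CARD('k)) (n i)"
  have xX: "x $ j \<le> ?X" for j
    by (rule order.trans[OF abs_ge_self]) (rule Max_ge, auto)
  have F: "\<bar>?F\<bar> \<le> exp (?X / 2)"
    using assms xX order.trans[OF assms(2) xX]
    by (intro abs_inverse_pochhammer_functional_le) auto
  have P: "?P > 0" using assms by (intro pochhammer_pos) auto
  have Q: "?Q > 0" by (intro prod_pos ballI pochhammer_pos) simp
  \<comment> \<open>Factor by factor, \<open>1 / k + i \<le> 1 + i\<close> for
    \<open>k \<ge> 1\<close>.\<close>
  have "pochhammer (1 / real CARD('k)) r \<le> fact r" for r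
    unfolding pochhammer_fact pochhammer_prod by (intro prod_mono) (auto intro!: add_right_mono)
  then have Q_le: "?Q \<le> (\<Prod>i\<in>UNIV. fact (n i))"
    by (intro prod_mono) (auto intro!: pochhammer_nonneg)
  have "erdelyi_laguerre \<alpha> n x = ?P / (\<Prod>i\<in>UNIV. fact (n i)) * ?F"
    using erdelyi_laguerre_Phi2[of \<alpha> n x] assms
      Phi2_eq_inverse_pochhammer_functional[of n "\<alpha> + 1" "\<lambda>i. x $ i"] by simp
  also have "\<bar>\<dots>\<bar> = ?P / (\<Prod>i\<in>UNIV. fact (n i)) * \<bar>?F\<bar>"
    using P by (simp add: abs_mult abs_prod)
  also have "\<dots> \<le> ?P / ?Q * exp (?X / 2)"
    using P Q Q_le F by (intro mult_mono divide_left_mono) (auto intro!: mult_pos_pos prod_pos)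
  also have "\<dots> \<le> 2 ^ (CARD('k) - 1) * (?P / ?Q * exp (?X / 2))"
    using P Q mult_right_mono[of 1 "2 ^ (CARD('k) - 1)" "?P / ?Q * exp (?X / 2)"] by simp
  finally show ?thesis by (simp only: mult.assoc)
qed

end
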